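(* Consider the local beam-splitter broadcasting protocol with reflectivity $R\in[0,1]$ applied to the $N$-qubit linear cluster state $$|C_N\rangle=\frac{1}{\sqrt{2^N}}\sum_{(s_1,\dots,s_N)\in\{0,1\}^N}(-1)^{\sum_{i=1}^{N-1}s_is_{i+1}}|s_1s_2\cdots s_N\rangle,$$ with copy fidelities $\mathcal{F}_1^{(N)}(R)$ (transmitted) and $\mathcal{F}_2^{(N)}(R)$ (reflected). Then for $N=3$ $$\mathcal{F}_1^{(3)}(R)=\frac{(5R^2-6R+2)(19R^4-51R^3+53R^2-24R+4)}{8(3R^2-3R+1)^3},$$ $$\mathcal{F}_2^{(3)}(R)=\frac{(2R^2-2R+1)(16R^4-32R^3+23R^2-7R+1)}{8(3R^2-3R+1)^3},$$ and these coincide, for all $R$, with the corresponding copy fidelities for the input $|\mathrm{GHZ}_3\rangle=\frac{1}{\sqrt2}(|000\rangle+|111\rangle)$; and for $N=4$ $$\mathcal{F}_1^{(4)}(R)=\frac{(5R^2-6R+2)^2(17R^4-48R^3+52R^2-24R+4)}{16(3R^2-3R+1)^4},$$ $$\mathcal{F}_2^{(4)}(R)=\frac{(2R^2-2R+1)^2(20R^4-40R^3+28R^2-8R+1)}{16(3R^2-3R+1)^4}.$$ In particular $\mathcal{F}_1^{(3)}(1/3)=\mathcal{F}_2^{(3)}(1/3)=\frac{95}{216}$ and $\mathcal{F}_1^{(4)}(1/3)=\mathcal{F}_2^{(4)}(1/3)=\frac{425}{1296}$.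
   Context: Local beam-splitter broadcasting protocol with reflectivity $R\in[0,1]$. Let $|\Phi_N\rangle$ be an $N$-qubit unit vector on qubits $1,\dots,N$. For each $j=1,\dots,N$ take an ancillary pair of qubits $a_j,b_j$ in the state $|\chi_j\rangle_{a_jb_j}=\frac{1}{\sqrt2}(|01\rangle-|10\rangle)$. The initial state on $3N$ qubits is $|\Psi_{\rm in}\rangle=|\Phi_N\rangle_{1\dots N}\otimes\bigotimes_{j=1}^N|\chi_j\rangle_{a_jb_j}$. Let $S_{j,a_j}$ be the swap operator exchanging qubits $j$ and $a_j$, and let $U_j=(1-R)\,\mathbf{1}-R\,S_{j,a_j}$. The unnormalised output is $|\Psi_{\rm out}\rangle=\left(\prod_{j=1}^N U_j\right)|\Psi_{\rm in}\rangle$. Let $\rho_1$ be the partial trace of $|\Psi_{\rm out}\rangle\langle\Psi_{\rm out}|$ over all qubits $a_j,b_j$ (so it acts on qubits $1,\dots,N$), and let $\rho_2$ be its partial trace over qubits $1,\dots,N$ and all $a_j$ (so it acts on qubits $b_1,\dots,b_N$). The copy fidelities for the input $|\Phi_N\rangle$ are $$\mathcal{F}_1^{(N)}=\frac{\langle\Phi_N|\rho_1|\Phi_N\rangle}{\langle\Psi_{\rm out}|\Psi_{\rm out}\rangle},\qquad \mathcal{F}_2^{(N)}=\frac{\langle\Phi_N|\rho_2|\Phi_N\rangle}{\langle\Psi_{\rm out}|\Psi_{\rm out}\rangle}.$$ *)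

theory Defs
  imports "HOL-Analysis.Finite_Product_Measure" "HOL-Combinatorics.Transposition"
begin

text \<open>
  A register is a finite set \<open>Q\<close> of qubit labels, and its computational basis consists of the
  extensional bit assignments on \<open>Q\<close> (\<open>False\<close> is the bit 0). Vectors and operators on the
  register are given by their coefficients in that basis; coefficients outside it are irrelevant.
\<close>

type_synonym 'q bits = "'q \<Rightarrow> bool"
type_synonym 'q ket = "'q bits \<Rightarrow> complex"
type_synonym 'q operator = "'q bits \<Rightarrow> 'q bits \<Rightarrow> complex"

definition basis :: "'q set \<Rightarrow> 'q bits set" where
  "basis Q = Q \<rightarrow>\<^sub>E (UNIV :: bool set)"

definition braket :: "'q set \<Rightarrow> 'q ket \<Rightarrow> 'q ket \<Rightarrow> complex" where
  "braket Q \<phi> \<psi> = (\<Sum>x\<in>basis Q. cnj (\<phi> x) * \<psi> x)"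

definition ketbra :: "'q ket \<Rightarrow> 'q operator" where
  "ketbra \<psi> = (\<lambda>x y. \<psi> x * cnj (\<psi> y))"

definition op_apply :: "'q set \<Rightarrow> 'q operator \<Rightarrow> 'q ket \<Rightarrow> 'q ket" where
  "op_apply Q \<rho> \<psi> = (\<lambda>x. \<Sum>y\<in>basis Q. \<rho> x y * \<psi> y)"

text \<open>Partial trace over \<open>T\<close> of an operator on \<open>K \<union> T\<close>, for disjoint \<open>K\<close> and \<open>T\<close>.\<close>

definition partial_trace :: "'q set \<Rightarrow> 'q set \<Rightarrow> 'q operator \<Rightarrow> 'q operator" where
  "partial_trace K T \<rho> = (\<lambda>x y. \<Sum>z\<in>basis T. \<rho> (merge K T (x, z)) (merge K T (y, z)))"

definition swap_op :: "'q \<Rightarrow> 'q \<Rightarrow> 'q ket \<Rightarrow> 'q ket" where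
  "swap_op p q \<psi> = (\<lambda>x. \<psi> (x \<circ> Transposition.transpose p q))"

text \<open>The labels \<open>Sys j\<close>, \<open>AncA j\<close>, \<open>AncB j\<close> are the qubits $j$, $a_j$, $b_j$.\<close>

datatype qubit = Sys nat | AncA nat | AncB nat

definition reg :: "(nat \<Rightarrow> qubit) \<Rightarrow> nat \<Rightarrow> qubit set" where
  "reg c N = c ` {1..N}"

definition full_reg :: "nat \<Rightarrow> qubit set" where
  "full_reg N = reg Sys N \<union> reg AncA N \<union> reg AncB N"

text \<open>
  The \<open>N\<close>-qubit vector \<open>\<Phi>\<close>, with qubits labelled \<open>1, \<dots>, N\<close>, on the register \<open>reg c N\<close>.
  The result only reads the bits of that register, so it also serves as a tensor factor.
\<close>

definition place :: "(nat \<Rightarrow> qubit) \<Rightarrow> nat \<Rightarrow> nat ket \<Rightarrow> qubit ket" where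
  "place c N \<Phi> = (\<lambda>x. \<Phi> (\<lambda>j\<in>{1..N}. x (c j)))"

definition singlet :: "bool \<Rightarrow> bool \<Rightarrow> complex" where
  "singlet u v = 1 / complex_of_real (sqrt 2) * (of_bool (\<not> u \<and> v) - of_bool (u \<and> \<not> v))"

definition psi_in :: "nat \<Rightarrow> nat ket \<Rightarrow> qubit ket" where
  "psi_in N \<Phi> = (\<lambda>x. place Sys N \<Phi> x * (\<Prod>j=1..N. singlet (x (AncA j)) (x (AncB j))))"

definition beam_splitter :: "real \<Rightarrow> nat \<Rightarrow> qubit ket \<Rightarrow> qubit ket" where
  "beam_splitter R j \<psi> =
     (\<lambda>x. complex_of_real (1 - R) * \<psi> x - complex_of_real R * swap_op (Sys j) (AncA j) \<psi> x)"

definition psi_out :: "nat \<Rightarrow> real \<Rightarrow> nat ket \<Rightarrow> qubit ket" where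
  "psi_out N R \<Phi> = fold (beam_splitter R) [1..<Suc N] (psi_in N \<Phi>)"

definition rho1 :: "nat \<Rightarrow> real \<Rightarrow> nat ket \<Rightarrow> qubit operator" where
  "rho1 N R \<Phi> =
     partial_trace (reg Sys N) (reg AncA N \<union> reg AncB N) (ketbra (psi_out N R \<Phi>))"

definition rho2 :: "nat \<Rightarrow> real \<Rightarrow> nat ket \<Rightarrow> qubit operator" where
  "rho2 N R \<Phi> =
     partial_trace (reg AncB N) (reg Sys N \<union> reg AncA N) (ketbra (psi_out N R \<Phi>))"

definition fidelity1 :: "nat \<Rightarrow> real \<Rightarrow> nat ket \<Rightarrow> complex" where
  "fidelity1 N R \<Phi> =
     braket (reg Sys N) (place Sys N \<Phi>) (op_apply (reg Sys N) (rho1 N R \<Phi>) (place Sys N \<Phi>))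
     / braket (full_reg N) (psi_out N R \<Phi>) (psi_out N R \<Phi>)"

definition fidelity2 :: "nat \<Rightarrow> real \<Rightarrow> nat ket \<Rightarrow> complex" where
  "fidelity2 N R \<Phi> =
     braket (reg AncB N) (place AncB N \<Phi>) (op_apply (reg AncB N) (rho2 N R \<Phi>) (place AncB N \<Phi>))
     / braket (full_reg N) (psi_out N R \<Phi>) (psi_out N R \<Phi>)"

definition cluster :: "nat \<Rightarrow> nat ket" where
  "cluster N = (\<lambda>s. 1 / complex_of_real (sqrt (2 ^ N)) *
     (-1) ^ (\<Sum>i\<in>{1..<N}. of_bool (s i) * of_bool (s (Suc i)) :: nat))"

definition ghz :: "nat \<Rightarrow> nat ket" where
  "ghz N = (\<lambda>s. 1 / complex_of_real (sqrt 2) *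
     (of_bool (\<forall>j\<in>{1..N}. \<not> s j) + of_bool (\<forall>j\<in>{1..N}. s j)))"

end

theory Submission
  imports Defs
begin

text \<open>
  Since every beam splitter touches only the qubits of its own site, tracing out ancillas leaves
  a four-copy contraction of the input state with one kernel per site, and for both copies this
  kernel has the form \<open>p [x = s] [y = t] + q [x = y] [s = t]\<close>. The pair \<open>(p, q)\<close> is
  \<open>((1-R)(1-2R), R\<^sup>2/2)\<close> for the transmitted and \<open>(R(1-R), (1-2R)\<^sup>2/2)\<close> for the reflected copy, and
  \<open>p + 2 q = 3R\<^sup>2 - 3R + 1\<close> is the factor that each site contributes to the norm.

  For a GHZ input only the constant bit strings contribute. For a cluster input the contraction is a
  chain whose sites carry four bits \<open>(x, y, s, t)\<close>. The kernel vanishes unless all four bits agree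
  (weight \<open>p + q\<close>), or \<open>x = s \<noteq> y = t\<close> (weight \<open>p\<close>), or \<open>x = y \<noteq> s = t\<close> (weight \<open>q\<close>), and the four
  cluster phases of an edge multiply to \<open>-1\<close> exactly when it joins the second kind to the third.
  This leaves a three-state transfer matrix.
\<close>

subsection \<open>Reduction to a four-copy contraction\<close>

lemma finite_basis [simp]: "finite Q \<Longrightarrow> finite (basis Q)"
  by (simp add: basis_def finite_PiE)

text \<open>Pulling back along \<open>c\<close> is a bijection between assignments on the register
  and bit strings on \<open>{1..N}\<close>, so sums over labelled qubits become sums over plain
  strings.\<close>

lemma sum_basis_reg:
  assumes "inj c"
  shows "(\<Sum>x\<in>basis (reg c N). g (\<lambda>j\<in>{1..N}. x (c j))) = (\<Sum>s\<in>basis {1..N}. g s)"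
proof (rule sum.reindex_bij_witness[where i = "\<lambda>s. \<lambda>q\<in>reg c N. s (inv c q)"
      and j = "\<lambda>x. \<lambda>j\<in>{1..N}. x (c j)"])
  show "(\<lambda>q\<in>reg c N. (\<lambda>j\<in>{1..N}. x (c j)) (inv c q)) = x" if "x \<in> basis (reg c N)" for x
    using that assms by (fastforce simp: basis_def reg_def fun_eq_iff PiE_def extensional_def)
  show "(\<lambda>j\<in>{1..N}. (\<lambda>q\<in>reg c N. s (inv c q)) (c j)) = s" if "s \<in> basis {1..N}" for s
    using that assms by (fastforce simp: basis_def reg_def fun_eq_iff PiE_def extensional_def)
qed (auto simp: basis_def)

lemma sum_basis_Un:
  assumes "K \<inter> T = {}"
  shows "(\<Sum>w\<in>basis (K \<union> T). g w) = (\<Sum>x\<in>basis K. \<Sum>z\<in>basis T. g (merge K T (x, z)))"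
  unfolding sum.cartesian_product
proof (rule sum.reindex_bij_witness[where i = "\<lambda>p. merge K T p"
        and j = "\<lambda>w. (restrict w K, restrict w T)"])
  show "merge K T (restrict w K, restrict w T) = w" if "w \<in> basis (K \<union> T)" for w
    using that by (auto simp: basis_def PiE_def extensional_def merge_def)
  then show "(case (restrict w K, restrict w T) of (x, z) \<Rightarrow> g (merge K T (x, z))) = g w"
    if "w \<in> basis (K \<union> T)" for w
    using that by simp
  show "(restrict (merge K T p) K, restrict (merge K T p) T) = p" if "p \<in> basis K \<times> basis T" for p
    using that assms by (cases p) (auto simp: basis_def PiE_restrict)
qed (use assms in \<open>auto simp: basis_def\<close>)

lemma sum_basis_prod:
  fixes f :: "'i \<Rightarrow> bool \<Rightarrow> complex"
  assumes "finite I"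
  shows "(\<Sum>s\<in>basis I. \<Prod>j\<in>I. f j (s j)) = (\<Prod>j\<in>I. \<Sum>b\<in>UNIV. f j b)"
  unfolding basis_def using prod_sum_PiE[OF assms, of "\<lambda>_. UNIV" f] by simp

section \<open>Kets with site-local amplitudes and their traces\<close>

text \<open>A linear map from one qubit to three, with amplitudes \<open>L j\<close>, is applied to
  \<open>\<Phi>\<close> at every site \<open>j\<close>. The amplitudes may vary with
  \<open>j\<close>, so that the states after only some of the beam splitters have this form
  too.\<close>

definition site_ket ::
  "(nat \<Rightarrow> qubit) \<Rightarrow> (nat \<Rightarrow> qubit) \<Rightarrow> (nat \<Rightarrow> qubit) \<Rightarrow> nat \<Rightarrow> nat ket
   \<Rightarrow> (nat \<Rightarrow> bool \<Rightarrow> bool \<Rightarrow> bool \<Rightarrow> bool \<Rightarrow> complex) \<Rightarrow> qubit ket" where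
  "site_ket c c' c'' N \<Phi> L = (\<lambda>w. \<Sum>s\<in>basis {1..N}. \<Phi> s *
     (\<Prod>j=1..N. L j (w (c j)) (w (c' j)) (w (c'' j)) (s j)))"

text \<open>The strings \<open>x\<close>, \<open>y\<close> come from the projection onto
  \<open>\<Phi>\<close>, and \<open>s\<close>, \<open>t\<close> from the ket and the bra of the
  traced output.\<close>

definition four_copy :: "nat \<Rightarrow> nat ket \<Rightarrow> (bool \<Rightarrow> bool \<Rightarrow> bool \<Rightarrow> bool \<Rightarrow> complex) \<Rightarrow> complex" where
  "four_copy N \<Phi> M = (\<Sum>x\<in>basis {1..N}. \<Sum>y\<in>basis {1..N}. \<Sum>s\<in>basis {1..N}. \<Sum>t\<in>basis {1..N}.
     cnj (\<Phi> x) * \<Phi> y * \<Phi> s * cnj (\<Phi> t) * (\<Prod>j=1..N. M (x j) (y j) (s j) (t j)))"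

definition site_trace ::
  "(bool \<Rightarrow> bool \<Rightarrow> bool \<Rightarrow> bool \<Rightarrow> complex) \<Rightarrow> bool \<Rightarrow> bool \<Rightarrow> bool \<Rightarrow> bool \<Rightarrow> complex" where
  "site_trace L x y s t = (\<Sum>a\<in>UNIV. \<Sum>b\<in>UNIV. L x a b s * cnj (L y a b t))"

text \<open>\<open>c\<close> labels the retained qubits, \<open>c'\<close> and \<open>c''\<close>
  the traced ones. Leaving these roles open lets one argument serve both copies.\<close>

locale registers =
  fixes c c' c'' :: "nat \<Rightarrow> qubit"
  assumes inj: "inj c" "inj c'" "inj c''"
    and dist: "\<And>i j. c i \<noteq> c' j" "\<And>i j. c i \<noteq> c'' j" "\<And>i j. c' i \<noteq> c'' j"
begin

lemma merge_reg:
  assumes "j \<in> {1..N}"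
  shows "merge (reg c N) (reg c' N \<union> reg c'' N) (x, z) (c j) = x (c j)"
    "merge (reg c N) (reg c' N \<union> reg c'' N) (x, z) (c' j) = z (c' j)"
    "merge (reg c N) (reg c' N \<union> reg c'' N) (x, z) (c'' j) = z (c'' j)"
    "merge (reg c' N) (reg c'' N) (x, z) (c' j) = x (c' j)"
    "merge (reg c' N) (reg c'' N) (x, z) (c'' j) = z (c'' j)"
  using assms dist dist[symmetric] by (auto simp: merge_def reg_def)

lemma reg_disjoint: "reg c N \<inter> (reg c' N \<union> reg c'' N) = {}" "reg c' N \<inter> reg c'' N = {}"
  using dist by (auto simp: reg_def)

lemma sum_traced:
  "(\<Sum>z\<in>basis (reg c' N \<union> reg c'' N). \<Prod>j=1..N. h j (z (c' j)) (z (c'' j)))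
     = (\<Prod>j=1..N. \<Sum>a\<in>UNIV. \<Sum>b\<in>UNIV. h j a b :: complex)"
proof -
  have "(\<Sum>z\<in>basis (reg c' N \<union> reg c'' N). \<Prod>j=1..N. h j (z (c' j)) (z (c'' j)))
      = (\<Sum>u\<in>basis (reg c' N). \<Sum>v\<in>basis (reg c'' N). \<Prod>j=1..N. h j (u (c' j)) (v (c'' j)))"
    by (simp add: sum_basis_Un reg_disjoint merge_reg)
  also have "\<dots> = (\<Sum>u\<in>basis (reg c' N). \<Prod>j=1..N. \<Sum>b\<in>UNIV. h j (u (c' j)) b)"
  proof (rule sum.cong[OF refl])
    fix u
    show "(\<Sum>v\<in>basis (reg c'' N). \<Prod>j=1..N. h j (u (c' j)) (v (c'' j)))
        = (\<Prod>j=1..N. \<Sum>b\<in>UNIV. h j (u (c' j)) b)"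
      using sum_basis_reg[OF inj(3), where N = N and g = "\<lambda>s. \<Prod>j=1..N. h j (u (c' j)) (s j)"]
        sum_basis_prod[of "{1..N}" "\<lambda>j. h j (u (c' j))"] by simp
  qed
  also have "\<dots> = (\<Prod>j=1..N. \<Sum>a\<in>UNIV. \<Sum>b\<in>UNIV. h j a b)"
    using sum_basis_reg[OF inj(2), where N = N and g = "\<lambda>s. \<Prod>j=1..N. \<Sum>b\<in>UNIV. h j (s j) b"]
      sum_basis_prod[of "{1..N}" "\<lambda>j a. \<Sum>b\<in>UNIV. h j a b"] by simp
  finally show ?thesis .
qed

text \<open>Once the sums over \<open>s\<close> and \<open>t\<close> stand outside, the traced bits
  occur in independent pairs, one pair per site, so the trace factorises over the sites.\<close>

lemma partial_trace_site_ket: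
  "partial_trace (reg c N) (reg c' N \<union> reg c'' N) (ketbra (site_ket c c' c'' N \<Phi> (\<lambda>_. L))) x y
    = (\<Sum>s\<in>basis {1..N}. \<Sum>t\<in>basis {1..N}. \<Phi> s * cnj (\<Phi> t) *
         (\<Prod>j=1..N. site_trace L (x (c j)) (y (c j)) (s j) (t j)))"
proof -
  have "partial_trace (reg c N) (reg c' N \<union> reg c'' N) (ketbra (site_ket c c' c'' N \<Phi> (\<lambda>_. L))) x y
    = (\<Sum>z\<in>basis (reg c' N \<union> reg c'' N). \<Sum>s\<in>basis {1..N}. \<Sum>t\<in>basis {1..N}. \<Phi> s * cnj (\<Phi> t) *
       (\<Prod>j=1..N. L (x (c j)) (z (c' j)) (z (c'' j)) (s j) * cnj (L (y (c j)) (z (c' j)) (z (c'' j)) (t j))))"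
    by (simp add: partial_trace_def ketbra_def site_ket_def merge_reg sum_product prod.distrib mult_ac)
  also have "\<dots> = (\<Sum>s\<in>basis {1..N}. \<Sum>t\<in>basis {1..N}. \<Sum>z\<in>basis (reg c' N \<union> reg c'' N). \<Phi> s * cnj (\<Phi> t) *
       (\<Prod>j=1..N. L (x (c j)) (z (c' j)) (z (c'' j)) (s j) * cnj (L (y (c j)) (z (c' j)) (z (c'' j)) (t j))))"
    by (subst sum.swap) (intro sum.cong refl sum.swap)
  also have "\<dots> = (\<Sum>s\<in>basis {1..N}. \<Sum>t\<in>basis {1..N}. \<Phi> s * cnj (\<Phi> t) *
         (\<Prod>j=1..N. site_trace L (x (c j)) (y (c j)) (s j) (t j)))"
    unfolding sum_distrib_left[symmetric] site_trace_def
    by (intro sum.cong refl arg_cong2[where f = "(*)"]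
        sum_traced[where N = N and h = "\<lambda>j a b. L (x (c j)) a b (_ j) * cnj (L (y (c j)) a b (_ j))"])
  finally show ?thesis .
qed

lemma fidelity_numerator:
  "braket (reg c N) (place c N \<Phi>)
     (op_apply (reg c N) (partial_trace (reg c N) (reg c' N \<union> reg c'' N)
        (ketbra (site_ket c c' c'' N \<Phi> (\<lambda>_. L)))) (place c N \<Phi>))
   = four_copy N \<Phi> (site_trace L)" (is "?lhs = _")
proof -
  define G where "G x y = (\<Sum>s\<in>basis {1..N}. \<Sum>t\<in>basis {1..N}. cnj (\<Phi> x) * \<Phi> y * \<Phi> s * cnj (\<Phi> t) *
         (\<Prod>j=1..N. site_trace L (x j) (y j) (s j) (t j)))" for x y
  have "?lhs = (\<Sum>x\<in>basis (reg c N). \<Sum>y\<in>basis (reg c N).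
      G (\<lambda>j\<in>{1..N}. x (c j)) (\<lambda>j\<in>{1..N}. y (c j)))"
    by (simp add: braket_def op_apply_def partial_trace_site_ket place_def G_def sum_distrib_left
        sum_distrib_right mult_ac)
  also have "\<dots> = (\<Sum>x\<in>basis {1..N}. \<Sum>y\<in>basis {1..N}. G x y)"
    unfolding sum_basis_reg[OF inj(1), where N = N and g = "G _"]
    using sum_basis_reg[OF inj(1), where N = N and g = "\<lambda>x. \<Sum>y\<in>basis {1..N}. G x y"] .
  finally show ?thesis
    by (simp add: G_def four_copy_def)
qed

text \<open>The squared norm is the trace of the partial trace, so each site contributes its site
  trace summed along the diagonal.\<close>

lemma braket_site_ket:
  "braket (reg c N \<union> (reg c' N \<union> reg c'' N)) (site_ket c c' c'' N \<Phi> (\<lambda>_. L)) (site_ket c c' c'' N \<Phi> (\<lambda>_. L))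
   = (\<Sum>s\<in>basis {1..N}. \<Sum>t\<in>basis {1..N}. \<Phi> s * cnj (\<Phi> t) *
       (\<Prod>j=1..N. \<Sum>x\<in>UNIV. site_trace L x x (s j) (t j)))" (is "?lhs = _")
proof -
  have "?lhs = (\<Sum>x\<in>basis (reg c N). 
      partial_trace (reg c N) (reg c' N \<union> reg c'' N) (ketbra (site_ket c c' c'' N \<Phi> (\<lambda>_. L))) x x)"
    unfolding braket_def partial_trace_def ketbra_def
    by (simp add: sum_basis_Un reg_disjoint mult.commute)
  also have "\<dots> = (\<Sum>x\<in>basis (reg c N). \<Sum>s\<in>basis {1..N}. \<Sum>t\<in>basis {1..N}. \<Phi> s * cnj (\<Phi> t) *
         (\<Prod>j=1..N. site_trace L (x (c j)) (x (c j)) (s j) (t j)))"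
    by (simp add: partial_trace_site_ket)
  also have "\<dots> = (\<Sum>s\<in>basis {1..N}. \<Sum>t\<in>basis {1..N}. \<Sum>x\<in>basis (reg c N). \<Phi> s * cnj (\<Phi> t) *
         (\<Prod>j=1..N. site_trace L (x (c j)) (x (c j)) (s j) (t j)))"
    by (subst sum.swap) (intro sum.cong refl sum.swap)
  also have "\<dots> = (\<Sum>s\<in>basis {1..N}. \<Sum>t\<in>basis {1..N}. \<Phi> s * cnj (\<Phi> t) *
       (\<Prod>j=1..N. \<Sum>x\<in>UNIV. site_trace L x x (s j) (t j)))"
  proof (intro sum.cong refl)
    fix s t
    show "(\<Sum>x\<in>basis (reg c N). \<Phi> s * cnj (\<Phi> t) *
           (\<Prod>j=1..N. site_trace L (x (c j)) (x (c j)) (s j) (t j)))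
       = \<Phi> s * cnj (\<Phi> t) * (\<Prod>j=1..N. \<Sum>x\<in>UNIV. site_trace L x x (s j) (t j))"
      using sum_basis_reg[OF inj(1), where N = N and g = "\<lambda>x. \<Prod>j=1..N. site_trace L (x j) (x j) (s j) (t j)"]
        sum_basis_prod[of "{1..N}" "\<lambda>j x. site_trace L x x (s j) (t j)"]
      by (simp flip: sum_distrib_left)
  qed
  finally show ?thesis .
qed

end

section \<open>The output state of the beam splitters\<close>

text \<open>The input bit \<open>s\<close> either stays on the system qubit while \<open>a\<close>,
  \<open>b\<close> carry the singlet, or is swapped onto the first ancilla, which leaves the singlet
  on \<open>x\<close>, \<open>b\<close>.\<close>

definition bs_amp :: "real \<Rightarrow> bool \<Rightarrow> bool \<Rightarrow> bool \<Rightarrow> bool \<Rightarrow> complex" where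
  "bs_amp R x a b s = complex_of_real (1 - R) * (of_bool (x = s) * singlet a b)
     - complex_of_real R * (of_bool (a = s) * singlet x b)"

lemma psi_in_site_ket:
  "psi_in N \<Phi> = site_ket Sys AncA AncB N \<Phi> (\<lambda>_ x a b s. of_bool (x = s) * singlet a b)"
proof
  fix w :: "qubit bits"
  define u where "u = (\<lambda>j\<in>{1..N}. w (Sys j))"
  define P where "P = (\<Prod>j=1..N. singlet (w (AncA j)) (w (AncB j)))"
  \<comment> \<open>The delta factors select the one string \<open>u\<close> read off the system
    qubits, so the sum over \<open>s\<close> has a single surviving term.\<close>
  have delta: "(\<Prod>j=1..N. of_bool (w (Sys j) = s j) :: complex) = of_bool (s = u)"
    if "s \<in> basis {1..N}" for s
  proof -
    have "s = u \<longleftrightarrow> (\<forall>j\<in>{1..N}. w (Sys j) = s j)"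
      using that by (auto simp: u_def basis_def fun_eq_iff PiE_def extensional_def)
    then show ?thesis
      by (auto simp: of_bool_def)
  qed
  have "u \<in> basis {1..N}"
    by (simp add: u_def basis_def)
  then have "psi_in N \<Phi> w = (\<Sum>s\<in>basis {1..N}. if s = u then \<Phi> s * P else 0)"
    by (simp add: psi_in_def place_def P_def u_def)
  also have "\<dots> = (\<Sum>s\<in>basis {1..N}. \<Phi> s * (of_bool (s = u) * P))"
    by (intro sum.cong) auto
  also have "\<dots> = site_ket Sys AncA AncB N \<Phi> (\<lambda>_ x a b s. of_bool (x = s) * singlet a b) w"
    by (simp add: site_ket_def prod.distrib delta P_def del: One_nat_def)
  finally show "psi_in N \<Phi> w = site_ket Sys AncA AncB N \<Phi> (\<lambda>_ x a b s. of_bool (x = s) * singlet a b) w" .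
qed

text \<open>The swap exchanges the first two arguments of the amplitude at site \<open>j\<close> and
  fixes the labels of all other sites.\<close>

lemma beam_splitter_site_ket:
  assumes "j \<in> {1..N}"
  shows "beam_splitter R j (site_ket Sys AncA AncB N \<Phi> L) =
    site_ket Sys AncA AncB N \<Phi> (L(j := (\<lambda>x a b s.
      complex_of_real (1 - R) * L j x a b s - complex_of_real R * L j a x b s)))"
proof
  fix w
  define rest where
    "rest s = (\<Prod>i\<in>{1..N} - {j}. L i (w (Sys i)) (w (AncA i)) (w (AncB i)) (s i))" for s
  have split: "(\<Prod>i=1..N. f i) = f j * (\<Prod>i\<in>{1..N} - {j}. f i)" for f :: "nat \<Rightarrow> complex"
    using assms by (simp add: prod.remove)
  have swapped: "(\<Prod>i\<in>{1..N} - {j}. L i (w (Transposition.transpose (Sys j) (AncA j) (Sys i)))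
      (w (Transposition.transpose (Sys j) (AncA j) (AncA i)))
      (w (Transposition.transpose (Sys j) (AncA j) (AncB i))) (s i)) = rest s" for s
    unfolding rest_def by (intro prod.cong) (auto simp: Transposition.transpose_def)
  have updated: "(\<Prod>i\<in>{1..N} - {j}. (L(j := f)) i (w (Sys i)) (w (AncA i)) (w (AncB i)) (s i)) = rest s"
    for s f
    unfolding rest_def by (intro prod.cong) auto
  show "beam_splitter R j (site_ket Sys AncA AncB N \<Phi> L) w =
    site_ket Sys AncA AncB N \<Phi> (L(j := (\<lambda>x a b s.
      complex_of_real (1 - R) * L j x a b s - complex_of_real R * L j a x b s))) w"
    unfolding beam_splitter_def swap_op_def site_ket_def split comp_def swapped updated
    unfolding rest_def[symmetric]
    by (simp add: Transposition.transpose_def sum_distrib_left sum_subtractf[symmetric] algebra_simps)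
qed

lemma psi_out_site_ket: "psi_out N R \<Phi> = site_ket Sys AncA AncB N \<Phi> (\<lambda>_. bs_amp R)"
proof -
  \<comment> \<open>Invariant after \<open>m\<close> beam splitters: sites \<open>1\<close> to
    \<open>m\<close> carry the final amplitude, later sites still the initial one.\<close>
  have "fold (beam_splitter R) [1..<Suc m] (psi_in N \<Phi>) = site_ket Sys AncA AncB N \<Phi>
      (\<lambda>j. if j \<in> {1..m} then bs_amp R else (\<lambda>x a b s. of_bool (x = s) * singlet a b))"
    if "m \<le> N" for m
    using that
  proof (induction m)
    case 0
    then show ?case by (simp add: psi_in_site_ket)
  next
    case (Suc m)
    have "fold (beam_splitter R) [1..<Suc (Suc m)] (psi_in N \<Phi>)
        = beam_splitter R (Suc m) (fold (beam_splitter R) [1..<Suc m] (psi_in N \<Phi>))"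
      by simp
    also have "\<dots> = site_ket Sys AncA AncB N \<Phi>
      (\<lambda>j. if j \<in> {1..Suc m} then bs_amp R else (\<lambda>x a b s. of_bool (x = s) * singlet a b))"
      unfolding Suc.IH[OF Suc_leD[OF Suc.prems]]
      by (subst beam_splitter_site_ket, use Suc.prems in simp)
        (rule arg_cong[where f = "site_ket Sys AncA AncB N \<Phi>"], auto simp: fun_eq_iff bs_amp_def)
    finally show ?case .
  qed
  from this[of N] show ?thesis
    unfolding psi_out_def by (simp add: site_ket_def)
qed

section \<open>Site kernels and the fidelities as contractions\<close>

text \<open>These are the coefficients of the one-qubit map X -> p X + q tr(X) 1, which has
  depolarising form.\<close>

definition mix :: "complex \<Rightarrow> complex \<Rightarrow> bool \<Rightarrow> bool \<Rightarrow> bool \<Rightarrow> bool \<Rightarrow> complex" where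
  "mix p q x y s t = p * of_bool (x = s \<and> y = t) + q * of_bool (x = y \<and> s = t)"

lemma singlet_simps:
  "singlet False False = 0" "singlet True True = 0"
  "singlet False True = 1 / complex_of_real (sqrt 2)"
  "singlet True False = - 1 / complex_of_real (sqrt 2)"
  by (simp_all add: singlet_def)

lemma csqrt2_sq: "complex_of_real (sqrt 2) * complex_of_real (sqrt 2) = 2"
  by (simp flip: of_real_mult)

text \<open>The direct terms give (1-R)^2 to the first weight and R^2/2 to the second; each of the
  two interference terms takes R(1-R)/2 from the first.\<close>

lemma site_trace_transmitted:
  "site_trace (bs_amp R) = mix (complex_of_real ((1 - R) * (1 - 2 * R))) (complex_of_real (R\<^sup>2 / 2))"
proof (intro ext)
  fix x y s t
  show "site_trace (bs_amp R) x y s t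
    = mix (complex_of_real ((1 - R) * (1 - 2 * R))) (complex_of_real (R\<^sup>2 / 2)) x y s t"
    by (cases x; cases y; cases s; cases t)
       (simp_all add: site_trace_def bs_amp_def mix_def UNIV_bool singlet_simps csqrt2_sq
          field_simps power2_eq_square)
qed

text \<open>Both direct terms go to the second weight, ((1-R)^2 + R^2)/2 in total. In the
  interference terms a product of two singlets is a difference of the two delta patterns, which
  moves R(1-R) from the second weight to the first.\<close>

lemma site_trace_reflected:
  "site_trace (\<lambda>b x a s. bs_amp R x a b s)
     = mix (complex_of_real (R * (1 - R))) (complex_of_real ((1 - 2 * R)\<^sup>2 / 2))"
proof (intro ext)
  fix x y s t
  show "site_trace (\<lambda>b x a s. bs_amp R x a b s) x y s t
    = mix (complex_of_real (R * (1 - R))) (complex_of_real ((1 - 2 * R)\<^sup>2 / 2)) x y s t"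
    by (cases x; cases y; cases s; cases t)
       (simp_all add: site_trace_def bs_amp_def mix_def UNIV_bool singlet_simps csqrt2_sq
          field_simps power2_eq_square)
qed

lemma prod_of_bool: "finite A \<Longrightarrow> (\<Prod>j\<in>A. of_bool (P j)) = (of_bool (\<forall>j\<in>A. P j) :: complex)"
  by (induction A rule: finite_induct) auto

text \<open>Summing over the retained bit leaves \<open>p + 2 * q\<close> times a delta of
  \<open>s\<close> and \<open>t\<close> at each site; together the deltas force
  \<open>s = t\<close>.\<close>

lemma (in registers) norm_site_ket:
  assumes "site_trace L = mix p q"
  shows "braket (reg c N \<union> (reg c' N \<union> reg c'' N)) (site_ket c c' c'' N \<Phi> (\<lambda>_. L))
      (site_ket c c' c'' N \<Phi> (\<lambda>_. L)) = (p + 2 * q) ^ N * braket {1..N} \<Phi> \<Phi>"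
proof -
  have site: "(\<Sum>x\<in>UNIV. mix p q x x u v) = (p + 2 * q) * of_bool (u = v)" for u v
    by (cases u; cases v) (simp_all add: mix_def UNIV_bool)
  have "(\<Sum>t\<in>basis {1..N}. \<Phi> s * cnj (\<Phi> t) * (\<Prod>j=1..N. \<Sum>x\<in>UNIV. mix p q x x (s j) (t j)))
      = (p + 2 * q) ^ N * (cnj (\<Phi> s) * \<Phi> s)" if s: "s \<in> basis {1..N}" for s
  proof -
    have "(\<Sum>t\<in>basis {1..N}. \<Phi> s * cnj (\<Phi> t) * (\<Prod>j=1..N. \<Sum>x\<in>UNIV. mix p q x x (s j) (t j)))
      = (\<Sum>t\<in>basis {1..N}. if s = t then (p + 2 * q) ^ N * (cnj (\<Phi> s) * \<Phi> s) else 0)"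
    proof (rule sum.cong[OF refl])
      fix t assume t: "t \<in> basis {1..N}"
      have "s = t \<longleftrightarrow> (\<forall>j\<in>{1..N}. s j = t j)"
        using s t by (auto simp: basis_def intro: PiE_ext)
      then show "\<Phi> s * cnj (\<Phi> t) * (\<Prod>j=1..N. \<Sum>x\<in>UNIV. mix p q x x (s j) (t j))
          = (if s = t then (p + 2 * q) ^ N * (cnj (\<Phi> s) * \<Phi> s) else 0)"
        by (auto simp: site prod.distrib prod_of_bool)
    qed
    also have "\<dots> = (p + 2 * q) ^ N * (cnj (\<Phi> s) * \<Phi> s)"
      using s by simp
    finally show ?thesis .
  qed
  then show ?thesis
    unfolding braket_site_ket assms by (simp add: braket_def sum_distrib_left del: One_nat_def)
qed

lemma fidelity1_four_copy:
  "fidelity1 N R \<Phi> =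
     four_copy N \<Phi> (mix (complex_of_real ((1 - R) * (1 - 2 * R))) (complex_of_real (R\<^sup>2 / 2)))
     / (complex_of_real (3 * R\<^sup>2 - 3 * R + 1) ^ N * braket {1..N} \<Phi> \<Phi>)"
proof -
  interpret registers Sys AncA AncB
    by unfold_locales (auto simp: inj_def)
  have "complex_of_real ((1 - R) * (1 - 2 * R)) + 2 * complex_of_real (R\<^sup>2 / 2)
      = complex_of_real (3 * R\<^sup>2 - 3 * R + 1)"
    by (simp add: field_simps power2_eq_square)
  then show ?thesis
    by (simp only: fidelity1_def rho1_def full_reg_def psi_out_site_ket Un_assoc
        fidelity_numerator norm_site_ket[OF site_trace_transmitted] site_trace_transmitted)
qed

lemma fidelity2_four_copy:
  "fidelity2 N R \<Phi> =
     four_copy N \<Phi> (mix (complex_of_real (R * (1 - R))) (complex_of_real ((1 - 2 * R)\<^sup>2 / 2)))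
     / (complex_of_real (3 * R\<^sup>2 - 3 * R + 1) ^ N * braket {1..N} \<Phi> \<Phi>)"
proof -
  \<comment> \<open>The reflected copy lives on the second ancillas, so \<open>AncB\<close> takes
    the retained place and the arguments of \<open>bs_amp\<close> are permuted to match.\<close>
  interpret registers AncB Sys AncA
    by unfold_locales (auto simp: inj_def)
  have "complex_of_real (R * (1 - R)) + 2 * complex_of_real ((1 - 2 * R)\<^sup>2 / 2)
      = complex_of_real (3 * R\<^sup>2 - 3 * R + 1)"
    by (simp add: field_simps power2_eq_square)
  moreover have "psi_out N R \<Phi> = site_ket AncB Sys AncA N \<Phi> (\<lambda>_ b x a s. bs_amp R x a b s)"
    by (simp add: psi_out_site_ket site_ket_def)
  moreover have "full_reg N = reg AncB N \<union> (reg Sys N \<union> reg AncA N)"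
    by (auto simp: full_reg_def)
  ultimately show ?thesis
    by (simp only: fidelity2_def rho2_def
        fidelity_numerator norm_site_ket[OF site_trace_reflected] site_trace_reflected)
qed

subsection \<open>GHZ input\<close>

lemma sum_ghz:
  "(\<Sum>s\<in>basis {1..N}. ghz N s * f s)
     = 1 / complex_of_real (sqrt 2) * (\<Sum>b\<in>UNIV. f (\<lambda>j\<in>{1..N}. b))"
proof -
  have const: "(\<lambda>j\<in>{1..N}. b) \<in> basis {1..N}" for b
    by (simp add: basis_def)
  \<comment> \<open>Summing over \<open>b\<close> keeps the equation valid at \<open>N = 0\<close>,
    where the two constant strings coincide and \<open>ghz\<close> counts both.\<close>
  have "ghz N s = (\<Sum>b\<in>UNIV. if s = (\<lambda>j\<in>{1..N}. b) then 1 / complex_of_real (sqrt 2) else 0)"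
    if s: "s \<in> basis {1..N}" for s
  proof -
    have "s = (\<lambda>j\<in>{1..N}. b) \<longleftrightarrow> (\<forall>j\<in>{1..N}. s j = b)" for b
      using s by (auto simp: basis_def fun_eq_iff PiE_def extensional_def)
    then show ?thesis
      by (simp add: ghz_def UNIV_bool)
  qed
  then have "(\<Sum>s\<in>basis {1..N}. ghz N s * f s)
      = (\<Sum>s\<in>basis {1..N}. \<Sum>b\<in>UNIV. if s = (\<lambda>j\<in>{1..N}. b) then 1 / complex_of_real (sqrt 2) * f s else 0)"
    by (auto simp: sum_distrib_right intro!: sum.cong)
  also have "\<dots> = (\<Sum>b\<in>UNIV. 1 / complex_of_real (sqrt 2) * f (\<lambda>j\<in>{1..N}. b))"
    by (subst sum.swap) (use const in simp)
  finally show ?thesis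
    by (simp add: sum_distrib_left)
qed

lemma cnj_ghz [simp]: "cnj (ghz N s) = ghz N s"
  by (simp add: ghz_def)

lemma braket_ghz:
  assumes "N \<noteq> 0"
  shows "braket {1..N} (ghz N) (ghz N) = 1"
proof -
  \<comment> \<open>The two constant strings differ at position 1, so exactly one indicator in
    \<open>ghz\<close> is nonzero on each.\<close>
  have "1 \<in> {1..N}"
    using assms by simp
  then have "ghz N (\<lambda>j\<in>{1..N}. b) = 1 / complex_of_real (sqrt 2)" for b
    by (cases b) (auto simp: ghz_def)
  then show ?thesis
    by (simp add: braket_def sum_ghz UNIV_bool csqrt2_sq del: One_nat_def)
qed

lemma four_copy_ghz:
  assumes "N \<noteq> 0"
  shows "four_copy N (ghz N) (mix p q) = ((p + q) ^ N + p ^ N + q ^ N) / 2"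
proof -
  have "four_copy N (ghz N) (mix p q) = (\<Sum>x\<in>basis {1..N}. ghz N x * (\<Sum>y\<in>basis {1..N}. ghz N y *
     (\<Sum>s\<in>basis {1..N}. ghz N s * (\<Sum>t\<in>basis {1..N}. ghz N t * (\<Prod>j=1..N. mix p q (x j) (y j) (s j) (t j))))))"
    by (simp add: four_copy_def sum_distrib_left mult_ac)
  also have "\<dots> = (1 / complex_of_real (sqrt 2)) ^ 4 *
      (\<Sum>x\<in>UNIV. \<Sum>y\<in>UNIV. \<Sum>s\<in>UNIV. \<Sum>t\<in>UNIV. mix p q x y s t ^ N)"
    unfolding sum_ghz by (simp add: sum_distrib_left power4_eq_xxxx mult.assoc)
  also have "(1 / complex_of_real (sqrt 2)) ^ 4 = 1 / 4"
    by (simp add: power4_eq_xxxx csqrt2_sq)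
  \<comment> \<open>Six bit patterns survive, two for each of the weights \<open>p + q\<close>,
    \<open>p\<close> and \<open>q\<close>; the others contribute \<open>0 ^ N\<close>, which is 0
    because \<open>N \<noteq> 0\<close>.\<close>
  also have "(\<Sum>x\<in>UNIV. \<Sum>y\<in>UNIV. \<Sum>s\<in>UNIV. \<Sum>t\<in>UNIV. mix p q x y s t ^ N)
      = 2 * ((p + q) ^ N + p ^ N + q ^ N)"
    using assms by (simp add: mix_def UNIV_bool)
  also have "1 / 4 * (2 * z) = z / 2" for z :: complex
    by simp
  finally show ?thesis .
qed

subsection \<open>Cluster input\<close>

type_synonym replicas = "bool \<times> bool \<times> bool \<times> bool"

definition edge :: "replicas \<Rightarrow> replicas \<Rightarrow> complex" where
  "edge = (\<lambda>(x, y, s, t) (x', y', s', t').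
     (-1) ^ (of_bool x * of_bool x' + of_bool y * of_bool y'
       + of_bool s * of_bool s' + of_bool t * of_bool t' :: nat))"

definition site :: "complex \<Rightarrow> complex \<Rightarrow> replicas \<Rightarrow> complex" where
  "site p q = (\<lambda>(x, y, s, t). mix p q x y s t)"

definition path_weight :: "complex \<Rightarrow> complex \<Rightarrow> nat \<Rightarrow> (nat \<Rightarrow> replicas) \<Rightarrow> complex" where
  "path_weight p q N \<sigma> = (\<Prod>j=1..N. site p q (\<sigma> j)) * (\<Prod>i=1..<N. edge (\<sigma> i) (\<sigma> (Suc i)))"

text \<open>A partition function of \<open>N\<close> sites whose last site is joined to an outer
  site with fixed bits \<open>e\<close>; this open end makes a recursion in \<open>N\<close>
  possible. Without sites there is no edge to draw.\<close>

definition chain :: "complex \<Rightarrow> complex \<Rightarrow> nat \<Rightarrow> replicas \<Rightarrow> complex" where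
  "chain p q N e = (\<Sum>\<sigma>\<in>{1..N} \<rightarrow>\<^sub>E UNIV. path_weight p q N \<sigma> * (if N = 0 then 1 else edge (\<sigma> N) e))"

lemma sum_PiE_Suc:
  "(\<Sum>\<sigma>\<in>{1..Suc n} \<rightarrow>\<^sub>E UNIV. f \<sigma>) = (\<Sum>a\<in>UNIV. \<Sum>\<sigma>\<in>{1..n} \<rightarrow>\<^sub>E UNIV. f (\<sigma>(Suc n := a)))"
proof -
  have restore: "(restrict \<sigma> {1..n})(Suc n := \<sigma> (Suc n)) = \<sigma>" if "\<sigma> \<in> {1..Suc n} \<rightarrow>\<^sub>E UNIV" for \<sigma>
    using that by (auto simp: PiE_def extensional_def fun_eq_iff)
  show ?thesis
    unfolding sum.cartesian_product
  proof (rule sum.reindex_bij_witness[where i = "\<lambda>(a, \<sigma>). \<sigma>(Suc n := a)"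
          and j = "\<lambda>\<sigma>. (\<sigma> (Suc n), restrict \<sigma> {1..n})"])
    show "(case (\<sigma> (Suc n), restrict \<sigma> {1..n}) of (a, \<tau>) \<Rightarrow> f (\<tau>(Suc n := a))) = f \<sigma>"
      if "\<sigma> \<in> {1..Suc n} \<rightarrow>\<^sub>E UNIV" for \<sigma>
      using restore[OF that] by simp
  qed (use restore in \<open>auto simp: PiE_def extensional_def fun_eq_iff\<close>)
qed

lemma chain_0 [simp]: "chain p q 0 e = 1"
  by (simp add: chain_def path_weight_def)

text \<open>Fixing the value \<open>a\<close> of the last site turns it into the outer site of the
  remaining chain.\<close>

lemma chain_Suc: "chain p q (Suc n) e = (\<Sum>a\<in>UNIV. site p q a * edge a e * chain p q n a)"
proof -
  have "path_weight p q (Suc n) (\<sigma>(Suc n := a))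
      = path_weight p q n \<sigma> * (if n = 0 then 1 else edge (\<sigma> n) a) * site p q a" for \<sigma> a
  proof -
    have "(\<Prod>j=1..Suc n. site p q ((\<sigma>(Suc n := a)) j)) = (\<Prod>j=1..n. site p q (\<sigma> j)) * site p q a"
      by simp
    moreover have "(\<Prod>i=1..<Suc n. edge ((\<sigma>(Suc n := a)) i) ((\<sigma>(Suc n := a)) (Suc i)))
        = (\<Prod>i=1..<n. edge (\<sigma> i) (\<sigma> (Suc i))) * (if n = 0 then 1 else edge (\<sigma> n) a)"
      by (cases n) simp_all
    ultimately show ?thesis
      by (simp add: path_weight_def)
  qed
  then show ?thesis
    unfolding chain_def sum_PiE_Suc by (simp add: sum_distrib_left mult_ac)
qed

lemma sum_replicas:
  "(\<Sum>a\<in>UNIV. f a) = (\<Sum>x\<in>UNIV. \<Sum>y\<in>UNIV. \<Sum>s\<in>UNIV. \<Sum>t\<in>UNIV. f (x, y, s, t :: bool))"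
  for f :: "replicas \<Rightarrow> complex"
  by (simp add: sum.cartesian_product case_prod_unfold)

text \<open>The entries belong to an outer site of the kinds all equal, x = s \<noteq> y = t, and x
  = y \<noteq> s = t. The factor 2 counts the two members of each kind, and the minus signs are the
  edges between the last two kinds.\<close>

fun transfer :: "complex \<Rightarrow> complex \<Rightarrow> nat \<Rightarrow> complex \<times> complex \<times> complex" where
  "transfer p q 0 = (1, 1, 1)"
| "transfer p q (Suc n) = (case transfer p q n of (c, a, b) \<Rightarrow>
     (2 * ((p + q) * c + p * a + q * b), 2 * ((p + q) * c + p * a - q * b),
      2 * ((p + q) * c - p * a + q * b)))"

text \<open>On the support of the kernel, the value depends only on the kind of the outer site.
  Keeping \<open>u\<close>, \<open>v\<close>, \<open>w\<close> arbitrary gives the induction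
  hypothesis for both members of each kind.\<close>

lemma chain_transfer:
  "(chain p q n (u, u, u, u), chain p q n (v, \<not> v, v, \<not> v), chain p q n (w, w, \<not> w, \<not> w))
     = transfer p q n"
proof (induction n arbitrary: u v w)
  case 0
  then show ?case by simp
next
  case (Suc n)
  obtain c a b where cab: "transfer p q n = (c, a, b)"
    by (cases "transfer p q n")
  have ih: "chain p q n (False, False, False, False) = c" "chain p q n (True, True, True, True) = c"
      "chain p q n (False, True, False, True) = a" "chain p q n (True, False, True, False) = a"
      "chain p q n (False, False, True, True) = b" "chain p q n (True, True, False, False) = b"
    using Suc.IH[of False False False] Suc.IH[of True True True] cab by auto
  show ?case
    by (cases u; cases v; cases w)
      (simp_all add: chain_Suc sum_replicas UNIV_bool site_def mix_def edge_def ih cab algebra_simps)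
qed

lemma cnj_cluster [simp]: "cnj (cluster N s) = cluster N s"
  by (simp add: cluster_def)

lemma csqrt_pow_sq: "complex_of_real (sqrt (2 ^ N)) * complex_of_real (sqrt (2 ^ N)) = 2 ^ N"
  by (simp flip: of_real_mult)

lemma braket_cluster: "braket {1..N} (cluster N) (cluster N) = 1"
proof -
  have "cluster N s * cluster N s = 1 / 2 ^ N" for s
    by (simp add: cluster_def csqrt_pow_sq flip: power_add mult_2)
  moreover have "card (basis {1..N}) = 2 ^ N"
    by (simp add: basis_def card_PiE)
  ultimately show ?thesis
    by (simp add: braket_def)
qed

text \<open>The phases regroup edge by edge, and the four normalisations multiply to
  \<open>1 / 4 ^ N\<close>.\<close>

lemma cluster_product:
  "cluster N x * cluster N y * cluster N s * cluster N t
     = (\<Prod>i=1..<N. edge (x i, y i, s i, t i) (x (Suc i), y (Suc i), s (Suc i), t (Suc i))) / 4 ^ N"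
proof -
  have "cluster N x * cluster N y * cluster N s * cluster N t
     = (\<Prod>i=1..<N. edge (x i, y i, s i, t i) (x (Suc i), y (Suc i), s (Suc i), t (Suc i))) /
       ((complex_of_real (sqrt (2 ^ N)) * complex_of_real (sqrt (2 ^ N))) *
        (complex_of_real (sqrt (2 ^ N)) * complex_of_real (sqrt (2 ^ N))))"
    by (simp add: cluster_def edge_def power_sum power_add prod.distrib mult.assoc
        del: sum_of_bool_mult_eq sum_mult_of_bool_eq sum_of_bool_eq flip: of_bool_conj)
  also have "(complex_of_real (sqrt (2 ^ N)) * complex_of_real (sqrt (2 ^ N))) *
        (complex_of_real (sqrt (2 ^ N)) * complex_of_real (sqrt (2 ^ N))) = 4 ^ N"
    by (simp add: csqrt_pow_sq flip: power_mult_distrib)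
  finally show ?thesis .
qed

text \<open>Zipping the four bit strings into one string of replicas turns the contraction into a
  sum over paths of the chain.\<close>

lemma four_copy_cluster:
  "four_copy N (cluster N) (mix p q) = fst (transfer p q N) / 4 ^ N"
proof -
  have "four_copy N (cluster N) (mix p q) = (\<Sum>(x, y, s, t)\<in>basis {1..N} \<times> basis {1..N} \<times> basis {1..N} \<times> basis {1..N}.
      path_weight p q N (\<lambda>j\<in>{1..N}. (x j, y j, s j, t j)) / 4 ^ N)"
    unfolding four_copy_def sum.cartesian_product cnj_cluster cluster_product path_weight_def site_def
    by (intro sum.cong refl) (auto simp: mult.commute)
  also have "\<dots> = (\<Sum>\<sigma>\<in>{1..N} \<rightarrow>\<^sub>E UNIV. path_weight p q N \<sigma> / 4 ^ N)"
    by (rule sum.reindex_bij_witness[where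
          i = "\<lambda>\<sigma>. (\<lambda>j\<in>{1..N}. fst (\<sigma> j), \<lambda>j\<in>{1..N}. fst (snd (\<sigma> j)),
             \<lambda>j\<in>{1..N}. fst (snd (snd (\<sigma> j))), \<lambda>j\<in>{1..N}. snd (snd (snd (\<sigma> j))))"
          and j = "\<lambda>(x, y, s, t). \<lambda>j\<in>{1..N}. (x j, y j, s j, t j)"])
       (auto simp: basis_def PiE_def extensional_def fun_eq_iff)
  \<comment> \<open>an edge to the all-zero site has phase 1, so it closes the chain without changing the sum\<close>
  also have "\<dots> = chain p q N (False, False, False, False) / 4 ^ N"
    by (auto simp: chain_def edge_def case_prod_unfold sum_divide_distrib intro!: sum.cong)
  also have "chain p q N (False, False, False, False) = fst (transfer p q N)"
    using chain_transfer[of p q N False] by (metis fst_conv)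
  finally show ?thesis .
qed

text \<open>Three transfer steps give the value of \<open>four_copy_ghz\<close> at
  \<open>N = 3\<close>, in accordance with the local unitary equivalence of the two states.\<close>

lemma four_copy_cluster_3:
  "four_copy 3 (cluster 3) (mix p q) = ((p + q) ^ 3 + p ^ 3 + q ^ 3) / 2"
  unfolding four_copy_cluster by (simp add: numeral_3_eq_3 field_simps)

lemma four_copy_cluster_4:
  "four_copy 4 (cluster 4) (mix p q) = (p + q)\<^sup>2 * (p\<^sup>2 + q\<^sup>2)"
  unfolding four_copy_cluster by (simp add: numeral_eq_Suc field_simps)

subsection \<open>Closed forms\<close>

lemma fidelity1_cluster_3: "fidelity1 3 R (cluster 3) = complex_of_real
    ((5*R^2 - 6*R + 2) * (19*R^4 - 51*R^3 + 53*R^2 - 24*R + 4) / (8 * (3*R^2 - 3*R + 1)^3))"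
proof -
  \<comment> \<open>With the weights as real numbers, only a polynomial identity in \<open>R\<close>
    remains.\<close>
  define p where "p = (1 - R) * (1 - 2 * R)"
  define q where "q = R\<^sup>2 / 2"
  have "fidelity1 3 R (cluster 3)
      = complex_of_real (((p + q) ^ 3 + p ^ 3 + q ^ 3) / 2 / (3 * R\<^sup>2 - 3 * R + 1) ^ 3)"
    unfolding fidelity1_four_copy four_copy_cluster_3 braket_cluster p_def[symmetric] q_def[symmetric]
    by simp
  also have "((p + q) ^ 3 + p ^ 3 + q ^ 3) / 2 =
      (5*R^2 - 6*R + 2) * (19*R^4 - 51*R^3 + 53*R^2 - 24*R + 4) / 8"
    unfolding p_def q_def by (simp add: field_simps eval_nat_numeral)
  finally show ?thesis
    by (simp only: divide_divide_eq_left)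
qed

lemma fidelity2_cluster_3: "fidelity2 3 R (cluster 3) = complex_of_real
    ((2*R^2 - 2*R + 1) * (16*R^4 - 32*R^3 + 23*R^2 - 7*R + 1) / (8 * (3*R^2 - 3*R + 1)^3))"
proof -
  define p where "p = R * (1 - R)"
  define q where "q = (1 - 2 * R)\<^sup>2 / 2"
  have "fidelity2 3 R (cluster 3)
      = complex_of_real (((p + q) ^ 3 + p ^ 3 + q ^ 3) / 2 / (3 * R\<^sup>2 - 3 * R + 1) ^ 3)"
    unfolding fidelity2_four_copy four_copy_cluster_3 braket_cluster p_def[symmetric] q_def[symmetric]
    by simp
  also have "((p + q) ^ 3 + p ^ 3 + q ^ 3) / 2 =
      (2*R^2 - 2*R + 1) * (16*R^4 - 32*R^3 + 23*R^2 - 7*R + 1) / 8"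
    unfolding p_def q_def by (simp add: field_simps eval_nat_numeral)
  finally show ?thesis
    by (simp only: divide_divide_eq_left)
qed

lemma fidelity1_cluster_4: "fidelity1 4 R (cluster 4) = complex_of_real
    ((5*R^2 - 6*R + 2)^2 * (17*R^4 - 48*R^3 + 52*R^2 - 24*R + 4) / (16 * (3*R^2 - 3*R + 1)^4))"
proof -
  define p where "p = (1 - R) * (1 - 2 * R)"
  define q where "q = R\<^sup>2 / 2"
  have "fidelity1 4 R (cluster 4)
      = complex_of_real ((p + q)\<^sup>2 * (p\<^sup>2 + q\<^sup>2) / (3 * R\<^sup>2 - 3 * R + 1) ^ 4)"
    unfolding fidelity1_four_copy four_copy_cluster_4 braket_cluster p_def[symmetric] q_def[symmetric]
    by simp
  also have "(p + q)\<^sup>2 * (p\<^sup>2 + q\<^sup>2) =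
      (5*R^2 - 6*R + 2)^2 * (17*R^4 - 48*R^3 + 52*R^2 - 24*R + 4) / 16"
    unfolding p_def q_def by (simp add: field_simps eval_nat_numeral)
  finally show ?thesis
    by (simp only: divide_divide_eq_left)
qed

lemma fidelity2_cluster_4: "fidelity2 4 R (cluster 4) = complex_of_real
    ((2*R^2 - 2*R + 1)^2 * (20*R^4 - 40*R^3 + 28*R^2 - 8*R + 1) / (16 * (3*R^2 - 3*R + 1)^4))"
proof -
  define p where "p = R * (1 - R)"
  define q where "q = (1 - 2 * R)\<^sup>2 / 2"
  have "fidelity2 4 R (cluster 4)
      = complex_of_real ((p + q)\<^sup>2 * (p\<^sup>2 + q\<^sup>2) / (3 * R\<^sup>2 - 3 * R + 1) ^ 4)"
    unfolding fidelity2_four_copy four_copy_cluster_4 braket_cluster p_def[symmetric] q_def[symmetric]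
    by simp
  also have "(p + q)\<^sup>2 * (p\<^sup>2 + q\<^sup>2) =
      (2*R^2 - 2*R + 1)^2 * (20*R^4 - 40*R^3 + 28*R^2 - 8*R + 1) / 16"
    unfolding p_def q_def by (simp add: field_simps eval_nat_numeral)
  finally show ?thesis
    by (simp only: divide_divide_eq_left)
qed

text \<open>Both inputs have norm 1 and the same contraction for every pair of weights.\<close>

lemma fidelity_cluster_3_eq_ghz:
  "fidelity1 3 R (cluster 3) = fidelity1 3 R (ghz 3)"
  "fidelity2 3 R (cluster 3) = fidelity2 3 R (ghz 3)"
  by (simp_all only: fidelity1_four_copy fidelity2_four_copy four_copy_cluster_3 braket_cluster
      four_copy_ghz[OF zero_neq_numeral[symmetric]] braket_ghz[OF zero_neq_numeral[symmetric]])

theorem mainTheorem5: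
  shows "(\<forall>R::real. 0 \<le> R \<and> R \<le> 1 \<longrightarrow>
      fidelity1 3 R (cluster 3) = complex_of_real
        ((5*R^2 - 6*R + 2) * (19*R^4 - 51*R^3 + 53*R^2 - 24*R + 4) / (8 * (3*R^2 - 3*R + 1)^3))
    \<and> fidelity2 3 R (cluster 3) = complex_of_real
        ((2*R^2 - 2*R + 1) * (16*R^4 - 32*R^3 + 23*R^2 - 7*R + 1) / (8 * (3*R^2 - 3*R + 1)^3))
    \<and> fidelity1 3 R (cluster 3) = fidelity1 3 R (ghz 3)
    \<and> fidelity2 3 R (cluster 3) = fidelity2 3 R (ghz 3)
    \<and> fidelity1 4 R (cluster 4) = complex_of_real
        ((5*R^2 - 6*R + 2)^2 * (17*R^4 - 48*R^3 + 52*R^2 - 24*R + 4) / (16 * (3*R^2 - 3*R + 1)^4))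
    \<and> fidelity2 4 R (cluster 4) = complex_of_real
        ((2*R^2 - 2*R + 1)^2 * (20*R^4 - 40*R^3 + 28*R^2 - 8*R + 1) / (16 * (3*R^2 - 3*R + 1)^4)))
    \<and> fidelity1 3 (1/3) (cluster 3) = 95/216 \<and> fidelity2 3 (1/3) (cluster 3) = 95/216
    \<and> fidelity1 4 (1/3) (cluster 4) = 425/1296 \<and> fidelity2 4 (1/3) (cluster 4) = 425/1296"
proof (intro conjI allI impI)
  show "fidelity1 3 (1/3) (cluster 3) = 95/216"
    unfolding fidelity1_cluster_3 by (simp add: power_divide)
  show "fidelity2 3 (1/3) (cluster 3) = 95/216"
    unfolding fidelity2_cluster_3 by (simp add: power_divide)
  show "fidelity1 4 (1/3) (cluster 4) = 425/1296"
    unfolding fidelity1_cluster_4 by (simp add: power_divide)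
  show "fidelity2 4 (1/3) (cluster 4) = 425/1296"
    unfolding fidelity2_cluster_4 by (simp add: power_divide)
qed (rule fidelity1_cluster_3 fidelity2_cluster_3 fidelity1_cluster_4 fidelity2_cluster_4
    fidelity_cluster_3_eq_ghz)+

end
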